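(* Let $(k_t)_{t\ge0}$ be the transition kernels of a stationary $\rhd$-homogeneous Markov process on $\mathbb R$, and for $f\in C_0(\mathbb R)$ let $$(S_tf)(x)=\int_{\mathbb R}f(y)\,k_t(x,dy),\qquad x\in\mathbb R,\ t\ge0.$$ Then the family $(S_t)_{t\ge0}$ is a Feller semigroup on $C_0(\mathbb R)$.
   Context: $\mathbb{C}^+=\{z\in\mathbb{C}:\operatorname{Im} z>0\}$. For a probability measure $\mu$ on $\mathbb{R}$, $G_\mu(z)=\int_{\mathbb R}\frac{1}{z-x}\mu(dx)$ and $F_\mu=1/G_\mu$ on $\mathbb C^+$. The monotone convolution $\mu\rhd\nu$ is the probability measure with $F_{\mu\rhd\nu}=F_\mu\circ F_\nu$. Transition kernels on $\mathbb R$ are probability kernels $(k_{st})_{0\le s\le t}$ with $k_{ss}(x,\cdot)=\delta_x$ and $k_{su}(x,B)=\int k_{st}(x,dy)k_{tu}(y,B)$ for $s\le t\le u$. A Markov process with these kernels is a process $(M_t)$ adapted to a filtration $(\mathcal F_t)$ with $\mathbb P[M_t\in B|\mathcal F_s]=k_{st}(M_s,B)$ a.s. It is $\rhd$-homogeneous if $(s,t)\mapsto k_{st}(x,\cdot)$ is weakly continuous for every $x\in\mathbb R$ and $\delta_x\rhd k_{st}(y,\cdot)=k_{st}(x+y,\cdot)$ for all $x,y\in\mathbb R$, $s\le t$. It is stationary if $k_{st}=k_{0,t-s}$; then one writes $k_t:=k_{0t}$. $C_0(\mathbb R)$ is the Banach space of continuous functions $\mathbb R\to\mathbb C$ vanishing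 at infinity, with the uniform norm. A one-parameter semigroup $(Q_t)_{t\ge0}$ of linear operators on $C_0(\mathbb R)$ is a Feller semigroup if (F1) $0\le Q_tf\le1$ whenever $0\le f\le1$ and $t\ge0$; (F2) $(Q_tf)(x)\to f(x)$ as $t\downarrow0$ for all $f\in C_0(\mathbb R)$ and $x\in\mathbb R$. *)

theory Defs
  imports "HOL-Probability.Probability" "HOL-Library.Complex_Order"
begin

definition cauchy_transform :: "real measure \<Rightarrow> complex \<Rightarrow> complex" where
  "cauchy_transform \<mu> z = (LINT x|\<mu>. 1 / (z - complex_of_real x))"

definition F_transform :: "real measure \<Rightarrow> complex \<Rightarrow> complex" where
  "F_transform \<mu> z = 1 / cauchy_transform \<mu> z"

text \<open>
  The monotone convolution is written as a relation: \<open>monotone_convolution \<mu> \<nu> \<rho>\<close> is to be read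
  as ``\<open>\<rho>\<close> is the monotone convolution of \<open>\<mu>\<close> and \<open>\<nu>\<close>''. A probability measure on the real
  line is determined by its F-transform on the upper half-plane, so at most one \<open>\<rho>\<close> qualifies.
\<close>

definition monotone_convolution :: "real measure \<Rightarrow> real measure \<Rightarrow> real measure \<Rightarrow> bool" where
  "monotone_convolution \<mu> \<nu> \<rho> \<longleftrightarrow>
     prob_space \<rho> \<and> sets \<rho> = sets borel \<and>
     (\<forall>z. Im z > 0 \<longrightarrow> F_transform \<rho> z = F_transform \<mu> (F_transform \<nu> z))"

text \<open>
  Times are real numbers, and only the values \<open>k s t\<close> with \<open>0 \<le> s \<le> t\<close> are relevant;
  \<open>k s t x\<close> is the probability measure \<open>k\<^sub>s\<^sub>t(x, \<cdot>)\<close>.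
\<close>

definition transition_kernels :: "(real \<Rightarrow> real \<Rightarrow> real \<Rightarrow> real measure) \<Rightarrow> bool" where
  "transition_kernels k \<longleftrightarrow>
     (\<forall>s t. 0 \<le> s \<and> s \<le> t \<longrightarrow> k s t \<in> borel \<rightarrow>\<^sub>M prob_algebra borel) \<and>
     (\<forall>s x. 0 \<le> s \<longrightarrow> k s s x = return borel x) \<and>
     (\<forall>s t u x. \<forall>B\<in>sets borel. 0 \<le> s \<and> s \<le> t \<and> t \<le> u \<longrightarrow>
        emeasure (k s u x) B = (\<integral>\<^sup>+ y. emeasure (k t u y) B \<partial>(k s t x)))"

definition markov_process ::
  "'a measure \<Rightarrow> (real \<Rightarrow> 'a measure) \<Rightarrow> (real \<Rightarrow> 'a \<Rightarrow> real)
     \<Rightarrow> (real \<Rightarrow> real \<Rightarrow> real \<Rightarrow> real measure) \<Rightarrow> bool" where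
  "markov_process P \<F> M k \<longleftrightarrow>
     prob_space P \<and>
     (\<forall>t\<ge>0. subalgebra P (\<F> t)) \<and>
     (\<forall>s t. 0 \<le> s \<and> s \<le> t \<longrightarrow> sets (\<F> s) \<subseteq> sets (\<F> t)) \<and>
     (\<forall>t\<ge>0. M t \<in> borel_measurable (\<F> t)) \<and>
     transition_kernels k \<and>
     (\<forall>s t. \<forall>B\<in>sets borel. 0 \<le> s \<and> s \<le> t \<longrightarrow>
        (AE \<omega> in P. real_cond_exp P (\<F> s) (indicator {\<omega> \<in> space P. M t \<omega> \<in> B}) \<omega>
                     = measure (k s t (M s \<omega>)) B))"

definition monotone_homogeneous :: "(real \<Rightarrow> real \<Rightarrow> real \<Rightarrow> real measure) \<Rightarrow> bool" where
  "monotone_homogeneous k \<longleftrightarrow>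
     (\<forall>x. \<forall>f :: real \<Rightarrow> real. continuous_on UNIV f \<and> bounded (range f) \<longrightarrow>
        continuous_on {(s, t). 0 \<le> s \<and> s \<le> t} (\<lambda>(s, t). LINT y|k s t x. f y)) \<and>
     (\<forall>x y s t. 0 \<le> s \<and> s \<le> t \<longrightarrow>
        monotone_convolution (return borel x) (k s t y) (k s t (x + y)))"

definition stationary_kernels :: "(real \<Rightarrow> real \<Rightarrow> real \<Rightarrow> real measure) \<Rightarrow> bool" where
  "stationary_kernels k \<longleftrightarrow> (\<forall>s t. 0 \<le> s \<and> s \<le> t \<longrightarrow> k s t = k 0 (t - s))"

definition C0 :: "(real \<Rightarrow> complex) set" where
  "C0 = {f. continuous_on UNIV f \<and> (f \<longlongrightarrow> 0) at_infinity}"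

definition linear_operator_C0 :: "((real \<Rightarrow> complex) \<Rightarrow> real \<Rightarrow> complex) \<Rightarrow> bool" where
  "linear_operator_C0 T \<longleftrightarrow>
     (\<forall>f\<in>C0. T f \<in> C0) \<and>
     (\<forall>f\<in>C0. \<forall>g\<in>C0. T (\<lambda>x. f x + g x) = (\<lambda>x. T f x + T g x)) \<and>
     (\<forall>f\<in>C0. \<forall>c. T (\<lambda>x. c * f x) = (\<lambda>x. c * T f x))"

text \<open>
  The order on \<^typ>\<open>complex\<close> is the one in which \<open>0 \<le> w\<close> and \<open>w \<le> 1\<close> mean that \<open>w\<close> is real
  and lies in the unit interval.
\<close>

definition Feller_semigroup :: "(real \<Rightarrow> (real \<Rightarrow> complex) \<Rightarrow> real \<Rightarrow> complex) \<Rightarrow> bool" where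
  "Feller_semigroup Q \<longleftrightarrow>
     (\<forall>t\<ge>0. linear_operator_C0 (Q t)) \<and>
     (\<forall>f\<in>C0. Q 0 f = f) \<and>
     (\<forall>s\<ge>0. \<forall>t\<ge>0. \<forall>f\<in>C0. Q (s + t) f = Q s (Q t f)) \<and>
     (\<forall>t\<ge>0. \<forall>f\<in>C0. (\<forall>x. 0 \<le> f x \<and> f x \<le> 1) \<longrightarrow> (\<forall>x. 0 \<le> Q t f x \<and> Q t f x \<le> 1)) \<and>
     (\<forall>f\<in>C0. \<forall>x. ((\<lambda>t. Q t f x) \<longlongrightarrow> f x) (at_right 0))"

end

theory Submission
  imports Defs
begin

text \<open>
  Homogeneity says \<open>F\<^bsub>k\<^sub>t(x)\<^esub> = F\<^bsub>k\<^sub>t(0)\<^esub> - x\<close>, so the Cauchy transform of \<open>k\<^sub>t(x, \<cdot>)\<close> at \<open>z\<close> is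
  \<open>1 / (w - x)\<close> with \<open>w = F\<^bsub>k\<^sub>t(0)\<^esub>(z)\<close> in the upper half-plane: it is continuous in \<open>x\<close> and vanishes
  as \<open>|x| \<rightarrow> \<infinity>\<close>. Pointwise convergence of Cauchy transforms entails convergence of the integrals of
  every \<open>f \<in> C\<^sub>0\<close>, because \<open>f\<close> is a uniform limit of Poisson integrals of integrable functions, and
  the integral of such a Poisson integral depends only on the Cauchy transform of the measure. Hence
  \<open>S\<^sub>t\<close> preserves \<open>C\<^sub>0\<close>; the remaining properties are those of any weakly continuous stationary
  family of transition kernels.
\<close>

section \<open>The Poisson kernel of the upper half-plane\<close>

text \<open>For \<open>0 < e\<close> this is the density of the Cauchy distribution with scale
  \<open>e\<close>; the factor \<open>pi\<close> makes its total mass 1.\<close>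

definition poisson_kernel :: "real \<Rightarrow> real \<Rightarrow> real" where
  "poisson_kernel e x = e / (pi * (x\<^sup>2 + e\<^sup>2))"

lemma poisson_kernel_measurable [measurable]: "poisson_kernel e \<in> borel_measurable borel"
  unfolding poisson_kernel_def by measurable

lemma poisson_kernel_nonneg: "0 < e \<Longrightarrow> 0 \<le> poisson_kernel e x"
  by (simp add: poisson_kernel_def)

lemma poisson_kernel_le: "0 < e \<Longrightarrow> poisson_kernel e x \<le> 1 / (pi * e)"
  by (auto simp: poisson_kernel_def power2_eq_square divide_simps add_pos_nonneg add_nonneg_pos)

lemma poisson_kernel_scale:
  assumes "0 < e"
  shows "e * poisson_kernel e (e * v) = poisson_kernel 1 v"
proof -
  have "pi * ((e * v)\<^sup>2 + e\<^sup>2) = e\<^sup>2 * (pi * (v\<^sup>2 + 1\<^sup>2))"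
    by (simp add: algebra_simps power2_eq_square)
  then show ?thesis
    using assms by (simp add: poisson_kernel_def power2_eq_square)
qed

text \<open>This is the bridge to Cauchy transforms: integrating over \<open>y\<close> against a
  measure turns the right-hand side into the imaginary part of its Cauchy transform at height
  \<open>e\<close>, as in Stieltjes inversion.\<close>

lemma poisson_kernel_eq_Im:
  assumes "0 < e"
  shows "poisson_kernel e (u - y) = - Im (1 / (Complex u e - complex_of_real y)) / pi"
  by (simp add: poisson_kernel_def Im_divide cmod_power2)

lemma poisson_kernel_1_integrable: "integrable lborel (poisson_kernel 1)"
  and poisson_kernel_1_integral: "integral\<^sup>L lborel (poisson_kernel 1) = 1"
proof -
  have eq: "poisson_kernel 1 = (\<lambda>x. inverse (1 + x\<^sup>2) / pi)"
    by (auto simp: poisson_kernel_def field_simps)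
  have "integrable lborel (\<lambda>x::real. inverse (1 + x\<^sup>2))"
    using integrable_inverse_1_plus_square by (simp add: set_integrable_def)
  then show "integrable lborel (poisson_kernel 1)"
    by (simp add: eq)
  have "(LINT x|lborel. inverse (1 + x\<^sup>2)) = pi"
    using LBINT_inverse_1_plus_square
    by (simp add: interval_lebesgue_integral_def set_lebesgue_integral_def)
  then show "integral\<^sup>L lborel (poisson_kernel 1) = 1"
    by (simp add: eq)
qed

section \<open>Continuous functions vanishing at infinity\<close>

lemma C0_measurable: "f \<in> C0 \<Longrightarrow> f \<in> borel_measurable borel"
  by (simp add: C0_def borel_measurable_continuous_onI)

lemma C0_small_outside:
  assumes "f \<in> C0" "0 < e"
  obtains R where "0 < R" "\<And>x. R \<le> \<bar>x\<bar> \<Longrightarrow> norm (f x) < e"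
proof -
  have "\<forall>\<^sub>F x in at_infinity. dist (f x) 0 < e"
    using assms by (intro tendstoD) (auto simp: C0_def)
  then obtain b where "\<And>x. b \<le> norm x \<Longrightarrow> norm (f x) < e"
    by (auto simp: eventually_at_infinity)
  then show ?thesis
    by (intro that[of "max 1 b"]) auto
qed

lemma C0_bounded:
  assumes "f \<in> C0"
  obtains B where "0 < B" "\<And>x. norm (f x) \<le> B"
proof -
  obtain R where R: "0 < R" "\<And>x. R \<le> \<bar>x\<bar> \<Longrightarrow> norm (f x) < 1"
    using C0_small_outside[OF assms, of 1] by auto
  have "compact (f ` {-R..R})"
    using assms by (intro compact_continuous_image) (auto simp: C0_def intro: continuous_on_subset)
  then obtain B where B: "\<And>x. x \<in> {-R..R} \<Longrightarrow> norm (f x) \<le> B"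
    using compact_imp_bounded by (force simp: bounded_iff)
  have "norm (f x) \<le> max 1 B" for x
    using R(2)[of x] B[of x] by (cases "R \<le> \<bar>x\<bar>") force+
  then show ?thesis
    by (intro that[of "max 1 B"]) auto
qed

text \<open>Heine-Cantor applies on a compact interval, and outside it \<open>f\<close> is too small
  to oscillate by \<open>e\<close>.\<close>

lemma C0_uniformly_continuous:
  assumes "f \<in> C0"
  shows "uniformly_continuous_on UNIV f"
  unfolding uniformly_continuous_on_def
proof (intro allI impI)
  fix e :: real assume "0 < e"
  obtain R where R: "0 < R" "\<And>x. R \<le> \<bar>x\<bar> \<Longrightarrow> norm (f x) < e/2"
    using C0_small_outside[OF assms, of "e/2"] \<open>0 < e\<close> by auto
  \<comment> \<open>The extra unit at each end matches the cap \<open>min 1 d\<close> below: two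
    points at distance less than 1, one of which lies strictly within \<open>R\<close> of the
    origin, both belong to this interval.\<close>
  have "uniformly_continuous_on {-R-1..R+1} f"
    using assms by (intro compact_uniformly_continuous) (auto simp: C0_def intro: continuous_on_subset)
  then obtain d where d: "0 < d"
    "\<And>x x'. \<lbrakk>x \<in> {-R-1..R+1}; x' \<in> {-R-1..R+1}; dist x' x < d\<rbrakk> \<Longrightarrow> dist (f x') (f x) < e"
    using \<open>0 < e\<close> unfolding uniformly_continuous_on_def by metis
  have "dist (f x') (f x) < e" if "dist x' x < min 1 d" for x x'
  proof (cases "R \<le> \<bar>x\<bar> \<and> R \<le> \<bar>x'\<bar>")
    case True
    then show ?thesis
      using R(2)[of x] R(2)[of x'] norm_triangle_ineq4[of "f x'" "f x"] by (simp add: dist_norm)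
  next
    case False
    with that have "x \<in> {-R-1..R+1}" "x' \<in> {-R-1..R+1}"
      by (auto simp: dist_real_def)
    with d(2) that show ?thesis by simp
  qed
  then show "\<exists>d>0. \<forall>x\<in>UNIV. \<forall>x'\<in>UNIV. dist x' x < d \<longrightarrow> dist (f x') (f x) < e"
    using d(1) by (intro exI[of _ "min 1 d"]) auto
qed

section \<open>Uniform approximation by Poisson integrals\<close>

text \<open>Cut \<open>f\<close> off to the interval from \<open>-n\<close> to \<open>n\<close> and
  smooth it with a kernel of width \<open>1 / (1 + n)\<close>. The cut-off makes \<phi> Lebesgue
  integrable, as the later use of Fubini requires, and costs little because \<open>f\<close> is
  small far out; the smoothing costs little because \<open>f\<close> is uniformly
  continuous.\<close>

lemma C0_poisson_approx:
  assumes f: "f \<in> C0" and "0 < e"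
  obtains d \<phi> where "0 < d" "integrable lborel \<phi>"
    "\<And>y. norm ((LINT v|lborel. poisson_kernel 1 v *\<^sub>R \<phi> (y + d * v)) - f y) \<le> e"
proof -
  define \<phi> where "\<phi> n = (\<lambda>u. indicator {- real n..real n} u *\<^sub>R f u)" for n
  define d where "d n = 1 / (1 + real n)" for n
  have d0: "0 < d n" for n by (simp add: d_def)
  note [measurable] = C0_measurable[OF f]
  have [measurable]: "\<phi> n \<in> borel_measurable borel" for n
    unfolding \<phi>_def by measurable
  have \<phi>_int: "integrable lborel (\<phi> n)" for n
    unfolding \<phi>_def using f
    by (intro borel_integrable_compact) (auto simp: C0_def intro: continuous_on_subset)
  obtain B where B: "0 < B" "\<And>x. norm (f x) \<le> B"
    using C0_bounded[OF f] by blast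
  have \<phi>_le: "norm (\<phi> n x) \<le> B" for n x
    using B by (auto simp: \<phi>_def indicator_def less_imp_le)
  \<comment> \<open>The base point may move with \<open>n\<close>; convergence along arbitrary
    sequences of base points is what yields uniformity in \<open>y\<close> below.\<close>
  have \<phi>_lim: "(\<lambda>n. \<phi> n (y n + d n * v) - f (y n)) \<longlonglongrightarrow> 0" for y :: "nat \<Rightarrow> real" and v
  proof -
    have "(\<lambda>n. \<phi> n (y n + d n * v) - f (y n + d n * v)) \<longlonglongrightarrow> 0"
    proof (rule tendsto_norm_zero_cancel, rule LIMSEQ_I)
      fix r :: real assume "0 < r"
      obtain R where R: "\<And>x. R \<le> \<bar>x\<bar> \<Longrightarrow> norm (f x) < r"
        using C0_small_outside[OF f \<open>0 < r\<close>] by metis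
      obtain N where N: "R \<le> real N" using real_arch_simple by blast
      have "norm (\<phi> n x - f x) < r" if "N \<le> n" for n x
        using R[of x] N that \<open>0 < r\<close> by (auto simp: \<phi>_def indicator_def)
      then show "\<exists>N. \<forall>n\<ge>N. norm (norm (\<phi> n (y n + d n * v) - f (y n + d n * v)) - 0) < r"
        by auto
    qed
    moreover have "(\<lambda>n. f (y n + d n * v) - f (y n)) \<longlonglongrightarrow> 0"
    proof -
      have "(\<lambda>n. d n * v) \<longlonglongrightarrow> 0"
        unfolding d_def by real_asymp
      then have "(\<lambda>n. dist (y n + d n * v) (y n)) \<longlonglongrightarrow> 0"
        by (simp add: dist_norm tendsto_rabs_zero)
      then have "(\<lambda>n. dist (f (y n + d n * v)) (f (y n))) \<longlonglongrightarrow> 0"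
        using C0_uniformly_continuous[OF f]
        unfolding uniformly_continuous_on_sequentially by auto
      then show ?thesis
        by (simp add: dist_norm tendsto_norm_zero_iff)
    qed
    ultimately show ?thesis
      using tendsto_add by fastforce
  qed
  have int1: "integrable lborel (\<lambda>v. poisson_kernel 1 v *\<^sub>R \<phi> n (y + d n * v))" for n y
    by (rule Bochner_Integration.integrable_bound[OF integrable_mult_right[OF poisson_kernel_1_integrable, of B]])
       (use \<phi>_le B(1) in \<open>auto simp: abs_mult mult.commute[of B] intro!: AE_I2 mult_left_mono\<close>)
  \<comment> \<open>The kernel has mass 1, so the constant \<open>f y\<close> can be moved under the
    integral.\<close>
  have eq: "(LINT v|lborel. poisson_kernel 1 v *\<^sub>R \<phi> n (y + d n * v)) - f y =
      (LINT v|lborel. poisson_kernel 1 v *\<^sub>R (\<phi> n (y + d n * v) - f y))" for n y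
    using int1[of n y] integrable_scaleR_left[OF poisson_kernel_1_integrable, of "f y"]
    by (simp add: scaleR_diff_right poisson_kernel_1_integrable poisson_kernel_1_integral)
  \<comment> \<open>If every \<open>n\<close> failed at some point \<open>y n\<close>, dominated
    convergence along these points, with \<open>2 * B\<close> times the kernel as the bound, would
    drive the error below \<open>e\<close>.\<close>
  have "\<exists>n. \<forall>y. norm ((LINT v|lborel. poisson_kernel 1 v *\<^sub>R \<phi> n (y + d n * v)) - f y) \<le> e"
  proof (rule ccontr)
    assume "\<not> ?thesis"
    then obtain y where y: "\<And>n. \<not> norm ((LINT v|lborel. poisson_kernel 1 v *\<^sub>R \<phi> n (y n + d n * v)) - f (y n)) \<le> e"
      by metis
    have "(\<lambda>n. LINT v|lborel. poisson_kernel 1 v *\<^sub>R (\<phi> n (y n + d n * v) - f (y n)))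
        \<longlonglongrightarrow> (LINT (v::real)|lborel. (0::complex))"
    proof (rule integral_dominated_convergence[where w = "\<lambda>v. (2 * B) * poisson_kernel 1 v"])
      show "AE v in lborel. (\<lambda>n. poisson_kernel 1 v *\<^sub>R (\<phi> n (y n + d n * v) - f (y n))) \<longlonglongrightarrow> 0"
        using tendsto_scaleR[OF tendsto_const \<phi>_lim] by (intro AE_I2) fastforce
      fix n
      have "norm (\<phi> n (y n + d n * v) - f (y n)) \<le> 2 * B" for v
        using norm_triangle_ineq4[of "\<phi> n (y n + d n * v)" "f (y n)"] \<phi>_le[of n "y n + d n * v"] B(2)[of "y n"]
        by simp
      then show "AE v in lborel. norm (poisson_kernel 1 v *\<^sub>R (\<phi> n (y n + d n * v) - f (y n))) \<le> 2 * B * poisson_kernel 1 v"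
        using poisson_kernel_nonneg[of 1]
        by (auto simp: mult.commute[of _ "poisson_kernel 1 _"] intro!: AE_I2 mult_left_mono)
    qed (use poisson_kernel_1_integrable in auto)
    then have "\<forall>\<^sub>F n in sequentially. dist (LINT v|lborel. poisson_kernel 1 v *\<^sub>R (\<phi> n (y n + d n * v) - f (y n))) 0 < e"
      using \<open>0 < e\<close> by (intro tendstoD) simp_all
    then obtain n where "norm (LINT v|lborel. poisson_kernel 1 v *\<^sub>R (\<phi> n (y n + d n * v) - f (y n))) < e"
      by (auto simp: eventually_sequentially)
    with y[of n] show False by (simp add: eq)
  qed
  then show ?thesis
    using that d0 \<phi>_int by blast
qed

text \<open>Substitute \<open>u = y + d * v\<close>. On the right \<open>y\<close> enters only
  through the kernel, so integration over \<open>y\<close> can later be carried out with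
  \<open>u\<close> fixed.\<close>

lemma poisson_kernel_convolution:
  fixes \<phi> :: "real \<Rightarrow> complex"
  assumes "0 < d"
  shows "(LINT v|lborel. poisson_kernel 1 v *\<^sub>R \<phi> (y + d * v)) =
         (LINT u|lborel. poisson_kernel d (u - y) *\<^sub>R \<phi> u)"
proof -
  have "(LINT u|lborel. poisson_kernel d (u - y) *\<^sub>R \<phi> u) =
      \<bar>d\<bar> *\<^sub>R (LINT v|lborel. poisson_kernel d (y + d * v - y) *\<^sub>R \<phi> (y + d * v))"
    using assms by (intro lborel_integral_real_affine) simp
  also have "\<dots> = (LINT v|lborel. (d * poisson_kernel d (d * v)) *\<^sub>R \<phi> (y + d * v))"
    using assms by (simp flip: integral_scaleR_right)
  finally show ?thesis
    using assms by (simp add: poisson_kernel_scale)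
qed

section \<open>Cauchy transforms determine integrals of functions in \<open>C0\<close>\<close>

text \<open>The distance from \<open>z\<close> to any point of the real line is at least
  \<open>Im z\<close>.\<close>

lemma norm_resolvent_le:
  assumes "0 < Im z"
  shows "norm (1 / (z - complex_of_real x)) \<le> 1 / Im z"
proof -
  have "Im z \<le> norm (z - complex_of_real x)"
    using abs_Im_le_cmod[of "z - complex_of_real x"] by simp
  then show ?thesis
    using assms by (simp add: norm_divide frac_le)
qed

lemma resolvent_integrable:
  assumes "finite_measure \<mu>" "sets \<mu> = sets borel" "0 < Im z"
  shows "integrable \<mu> (\<lambda>x. 1 / (z - complex_of_real x))"
proof (rule finite_measure.integrable_const_bound[OF assms(1)])
  show "AE x in \<mu>. norm (1 / (z - complex_of_real x)) \<le> 1 / Im z"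
    using norm_resolvent_le[OF assms(3)] by simp
  show "(\<lambda>x. 1 / (z - complex_of_real x)) \<in> borel_measurable \<mu>"
    unfolding measurable_cong_sets[OF assms(2) refl] by measurable
qed

lemma subprob_integral_norm_le:
  fixes f :: "real \<Rightarrow> complex"
  assumes "subprob_space \<mu>" "\<And>x. norm (f x) \<le> B"
  shows "norm (integral\<^sup>L \<mu> f) \<le> B"
proof -
  interpret subprob_space \<mu> by fact
  have "0 \<le> B" using assms(2) norm_ge_zero order_trans by blast
  show ?thesis
  proof (cases "integrable \<mu> f")
    case True
    have "norm (integral\<^sup>L \<mu> f) \<le> (LINT x|\<mu>. norm (f x))" by simp
    also have "\<dots> \<le> (LINT x|\<mu>. B)"
      using True assms(2) by (intro integral_mono) auto
    also have "\<dots> = measure \<mu> (space \<mu>) * B" by simp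
    also have "\<dots> \<le> 1 * B"
      using \<open>0 \<le> B\<close> subprob_measure_le_1 by (intro mult_right_mono)
    finally show ?thesis by simp
  \<comment> \<open>A function that is not integrable has integral 0 by convention, so
    \<open>0 \<le> B\<close> suffices.\<close>
  qed (use \<open>0 \<le> B\<close> not_integrable_integral_eq in force)
qed

text \<open>Fubini lets the integral over \<mu> act on the kernel alone, where
  \<open>poisson_kernel_eq_Im\<close> produces the Cauchy transform at height
  \<open>d\<close>.\<close>

lemma integral_poisson_convolution:
  fixes \<phi> :: "real \<Rightarrow> complex"
  assumes \<mu>: "subprob_space \<mu>" "sets \<mu> = sets borel" and "0 < d" and \<phi>: "integrable lborel \<phi>"
  shows "integrable \<mu> (\<lambda>y. LINT u|lborel. poisson_kernel d (u - y) *\<^sub>R \<phi> u)"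
    and "(LINT y|\<mu>. LINT u|lborel. poisson_kernel d (u - y) *\<^sub>R \<phi> u) =
         (LINT u|lborel. (- Im (cauchy_transform \<mu> (Complex u d)) / pi) *\<^sub>R \<phi> u)"
proof -
  interpret subprob_space \<mu> by fact
  interpret pair_sigma_finite \<mu> lborel ..
  have [measurable_cong]: "sets \<mu> = sets borel" by fact
  have [measurable]: "\<phi> \<in> borel_measurable borel" using \<phi> by auto
  \<comment> \<open>This bound does not depend on \<open>y\<close>; since \<mu> is finite and \<phi>
    is integrable, it gives integrability on the product space.\<close>
  have dom: "norm (poisson_kernel d (u - y) *\<^sub>R \<phi> u) \<le> norm ((1 / (pi * d)) *\<^sub>R \<phi> u)" for u y
    using poisson_kernel_nonneg[of d "u - y"] poisson_kernel_le[of d "u - y"] \<open>0 < d\<close>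
    using mult_right_mono[of "poisson_kernel d (u - y)" "1 / (pi * d)" "norm (\<phi> u)"] by simp
  have int_u: "integrable lborel (\<lambda>u. poisson_kernel d (u - y) *\<^sub>R \<phi> u)" for y
    by (rule Bochner_Integration.integrable_bound[OF integrable_scaleR_right[OF \<phi>, of "1 / (pi * d)"]])
       (use dom in auto)
  have int: "integrable (\<mu> \<Otimes>\<^sub>M lborel) (\<lambda>(y, u). poisson_kernel d (u - y) *\<^sub>R \<phi> u)"
  proof (rule Fubini_integrable)
    show "integrable \<mu> (\<lambda>y. LINT u|lborel. norm (case (y, u) of (y, u) \<Rightarrow> poisson_kernel d (u - y) *\<^sub>R \<phi> u))"
    proof (rule integrable_const_bound[where B = "LINT u|lborel. norm ((1 / (pi * d)) *\<^sub>R \<phi> u)"])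
      have "(LINT u|lborel. norm (poisson_kernel d (u - y) *\<^sub>R \<phi> u))
          \<le> (LINT u|lborel. norm ((1 / (pi * d)) *\<^sub>R \<phi> u))" for y
        using int_u \<phi> dom by (intro integral_mono integrable_norm integrable_scaleR_right) auto
      then show "AE y in \<mu>. norm (LINT u|lborel. norm (case (y, u) of (y, u) \<Rightarrow> poisson_kernel d (u - y) *\<^sub>R \<phi> u))
          \<le> (LINT u|lborel. norm ((1 / (pi * d)) *\<^sub>R \<phi> u))"
        by (simp del: norm_scaleR)
    qed simp
  qed (use int_u in auto)
  show "integrable \<mu> (\<lambda>y. LINT u|lborel. poisson_kernel d (u - y) *\<^sub>R \<phi> u)"
    using integrable_fst'[OF int] by simp
  have inner: "(LINT y|\<mu>. poisson_kernel d (u - y) *\<^sub>R \<phi> u) =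
      (- Im (cauchy_transform \<mu> (Complex u d)) / pi) *\<^sub>R \<phi> u" for u
  proof -
    have i: "integrable \<mu> (\<lambda>x. 1 / (Complex u d - complex_of_real x))"
      using \<mu> \<open>0 < d\<close> by (intro resolvent_integrable) (auto intro: finite_measure_axioms)
    have "(LINT y|\<mu>. poisson_kernel d (u - y)) = - Im (cauchy_transform \<mu> (Complex u d)) / pi"
      unfolding cauchy_transform_def poisson_kernel_eq_Im[OF \<open>0 < d\<close>]
      using integral_Im[OF i] by simp
    moreover have "integrable \<mu> (\<lambda>y. poisson_kernel d (u - y))"
      unfolding poisson_kernel_eq_Im[OF \<open>0 < d\<close>] using integrable_Im[OF i] by simp
    ultimately show ?thesis by simp
  qed
  have "(LINT y|\<mu>. LINT u|lborel. poisson_kernel d (u - y) *\<^sub>R \<phi> u) =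
      (LINT u|lborel. LINT y|\<mu>. poisson_kernel d (u - y) *\<^sub>R \<phi> u)"
    using Fubini_integral[OF int] by (simp only: case_prod_conv)
  also have "\<dots> = (LINT u|lborel. (- Im (cauchy_transform \<mu> (Complex u d)) / pi) *\<^sub>R \<phi> u)"
    by (simp only: inner)
  finally show "(LINT y|\<mu>. LINT u|lborel. poisson_kernel d (u - y) *\<^sub>R \<phi> u) =
      (LINT u|lborel. (- Im (cauchy_transform \<mu> (Complex u d)) / pi) *\<^sub>R \<phi> u)" .
qed


text \<open>
  The limit may be a sub-probability measure: mass escaping to infinity corresponds to
  \<open>\<nu> = null_measure borel\<close>.
\<close>

lemma integral_C0_tendsto:
  assumes \<mu>: "\<And>n. subprob_space (\<mu> n)" "\<And>n. sets (\<mu> n) = sets borel"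
    and \<nu>: "subprob_space \<nu>" "sets \<nu> = sets borel"
    and lim: "\<And>z. 0 < Im z \<Longrightarrow> (\<lambda>n. cauchy_transform (\<mu> n) z) \<longlonglongrightarrow> cauchy_transform \<nu> z"
    and f: "f \<in> C0"
  shows "(\<lambda>n. integral\<^sup>L (\<mu> n) f) \<longlonglongrightarrow> integral\<^sup>L \<nu> f"
proof (rule tendstoI)
  fix e :: real assume "0 < e"
  \<comment> \<open>Three errors add up at the end: at most \<open>e / 4\<close> each for replacing
    \<open>f\<close> by its Poisson approximation under \<open>\<mu> n\<close> and under \<nu>, and
    less than \<open>e / 4\<close> from the convergence of the approximating integrals.\<close>
  obtain d \<phi> where d: "0 < d" and \<phi>: "integrable lborel \<phi>"
    and approx: "\<And>y. norm ((LINT v|lborel. poisson_kernel 1 v *\<^sub>R \<phi> (y + d * v)) - f y) \<le> e / 4"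
    using C0_poisson_approx[OF f, of "e / 4"] \<open>0 < e\<close> by auto
  define h where "h y = (LINT u|lborel. poisson_kernel d (u - y) *\<^sub>R \<phi> u)" for y
  obtain B where B: "\<And>x. norm (f x) \<le> B"
    using C0_bounded[OF f] by blast
  \<comment> \<open>The approximation is uniform in \<open>y\<close>, so its cost is the same for
    all measures of mass at most 1, in particular independent of \<open>n\<close>.\<close>
  have near: "norm (integral\<^sup>L \<rho> h - integral\<^sup>L \<rho> f) \<le> e / 4"
    if \<rho>: "subprob_space \<rho>" "sets \<rho> = sets borel" for \<rho>
  proof -
    interpret subprob_space \<rho> by fact
    have "integrable \<rho> f"
      using B C0_measurable[OF f] by (intro integrable_const_bound[of _ B]) (auto cong: measurable_cong_sets simp: \<rho>(2))
    moreover have "integrable \<rho> h"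
      unfolding h_def by (rule integral_poisson_convolution(1)[OF \<rho> d \<phi>])
    ultimately have "integral\<^sup>L \<rho> h - integral\<^sup>L \<rho> f = (LINT y|\<rho>. h y - f y)"
      by simp
    also have "norm \<dots> \<le> e / 4"
      using approx by (intro subprob_integral_norm_le \<rho>) (simp add: h_def poisson_kernel_convolution[OF d])
    finally show ?thesis .
  qed
  have "(\<lambda>n. integral\<^sup>L (\<mu> n) h) \<longlonglongrightarrow> integral\<^sup>L \<nu> h"
    unfolding h_def integral_poisson_convolution(2)[OF \<mu> d \<phi>] integral_poisson_convolution(2)[OF \<nu> d \<phi>]
  proof (rule integral_dominated_convergence[where w = "\<lambda>u. norm ((1 / (pi * d)) *\<^sub>R \<phi> u)"])
    have meas: "(\<lambda>u. cauchy_transform \<rho> (Complex u d)) \<in> borel_measurable borel"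
      if \<rho>: "subprob_space \<rho>" "sets \<rho> = sets borel" for \<rho>
    proof -
      interpret subprob_space \<rho> by fact
      have [measurable_cong]: "sets \<rho> = sets borel" by fact
      have "(\<lambda>u. Complex u d) \<in> borel_measurable borel"
        by (intro borel_measurable_continuous_onI continuous_intros)
      note [measurable] = this
      show ?thesis
        unfolding cauchy_transform_def by measurable
    qed
    note [measurable] = meas[OF \<mu>] meas[OF \<nu>]
    have [measurable]: "\<phi> \<in> borel_measurable borel" using \<phi> by auto
    show "(\<lambda>u. (- Im (cauchy_transform \<nu> (Complex u d)) / pi) *\<^sub>R \<phi> u) \<in> borel_measurable lborel"
      by simp
    show "(\<lambda>u. (- Im (cauchy_transform (\<mu> n) (Complex u d)) / pi) *\<^sub>R \<phi> u) \<in> borel_measurable lborel" for n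
      by simp
    show "integrable lborel (\<lambda>u. norm ((1 / (pi * d)) *\<^sub>R \<phi> u))"
      using \<phi> by (intro integrable_norm integrable_scaleR_right)
    show "AE u in lborel. (\<lambda>n. (- Im (cauchy_transform (\<mu> n) (Complex u d)) / pi) *\<^sub>R \<phi> u)
        \<longlonglongrightarrow> (- Im (cauchy_transform \<nu> (Complex u d)) / pi) *\<^sub>R \<phi> u"
      using lim d by (intro AE_I2 tendsto_intros) auto
    fix n
    \<comment> \<open>All points \<open>Complex u d\<close> have height \<open>d\<close>, so the
      resolvent bound is uniform in \<open>u\<close> and \<open>n\<close> and provides the
      dominating function.\<close>
    have "\<bar>Im (cauchy_transform (\<mu> n) (Complex u d))\<bar> \<le> 1 / d" for u
    proof -
      have "norm (cauchy_transform (\<mu> n) (Complex u d)) \<le> 1 / d"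
        unfolding cauchy_transform_def
        using norm_resolvent_le[of "Complex u d"] d by (intro subprob_integral_norm_le \<mu>) auto
      then show ?thesis
        using abs_Im_le_cmod order_trans by blast
    qed
    then have "\<bar>- Im (cauchy_transform (\<mu> n) (Complex u d)) / pi\<bar> \<le> 1 / (pi * d)" for u
      using divide_right_mono[of _ "1 / d" pi] by (simp add: mult.commute)
    then show "AE u in lborel. norm ((- Im (cauchy_transform (\<mu> n) (Complex u d)) / pi) *\<^sub>R \<phi> u)
        \<le> norm ((1 / (pi * d)) *\<^sub>R \<phi> u)"
      using d mult_right_mono[OF _ norm_ge_zero] by (intro AE_I2) (simp only: norm_scaleR, fastforce)
  qed
  then have "\<forall>\<^sub>F n in sequentially. dist (integral\<^sup>L (\<mu> n) h) (integral\<^sup>L \<nu> h) < e / 4"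
    using \<open>0 < e\<close> by (intro tendstoD) auto
  then show "\<forall>\<^sub>F n in sequentially. dist (integral\<^sup>L (\<mu> n) f) (integral\<^sup>L \<nu> f) < e"
  proof eventually_elim
    case (elim n)
    have "integral\<^sup>L (\<mu> n) f - integral\<^sup>L \<nu> f =
        (integral\<^sup>L (\<mu> n) h - integral\<^sup>L \<nu> h) - (integral\<^sup>L (\<mu> n) h - integral\<^sup>L (\<mu> n) f)
        + (integral\<^sup>L \<nu> h - integral\<^sup>L \<nu> f)"
      by simp
    also have "norm \<dots> \<le> norm (integral\<^sup>L (\<mu> n) h - integral\<^sup>L \<nu> h)
        + norm (integral\<^sup>L (\<mu> n) h - integral\<^sup>L (\<mu> n) f) + norm (integral\<^sup>L \<nu> h - integral\<^sup>L \<nu> f)"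
      by (meson add_right_mono norm_triangle_ineq norm_triangle_ineq4 order_trans)
    also have "\<dots> < e"
      using elim near[OF \<mu>, of n] near[OF \<nu>] \<open>0 < e\<close> by (simp add: dist_norm)
    finally show ?case by (simp add: dist_norm)
  qed
qed

section \<open>F-transforms on the upper half-plane\<close>

lemma cauchy_transform_eq: "cauchy_transform \<mu> z = 1 / F_transform \<mu> z"
  by (simp add: F_transform_def)

lemma F_transform_return: "F_transform (return borel x) z = z - complex_of_real x"
proof -
  have "cauchy_transform (return borel x) z = 1 / (z - complex_of_real x)"
    unfolding cauchy_transform_def by (rule integral_return) auto
  then show ?thesis by (simp add: F_transform_def)
qed

text \<open>The resolvent has negative imaginary part at every real point, hence so has its mean;
  taking the reciprocal flips the sign.\<close>

lemma Im_F_transform_pos: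
  assumes "prob_space \<mu>" "sets \<mu> = sets borel" "0 < Im z"
  shows "0 < Im (F_transform \<mu> z)"
proof -
  interpret prob_space \<mu> by fact
  have i: "integrable \<mu> (\<lambda>x. 1 / (z - complex_of_real x))"
    using assms by (intro resolvent_integrable) (auto intro: finite_measure_axioms)
  have pos: "0 < - Im (1 / (z - complex_of_real x))" for x
    using assms(3) by (auto simp: Im_divide intro!: divide_pos_pos add_nonneg_pos)
  have "0 < (LINT x|\<mu>. - Im (1 / (z - complex_of_real x)))"
    using i pos by (intro integral_less_AE_space[of "\<lambda>_. 0", simplified]) (auto simp: emeasure_space_1)
  also have "\<dots> = - Im (cauchy_transform \<mu> z)"
    unfolding cauchy_transform_def using integral_Im[OF i] by simp
  finally show ?thesis
    by (auto simp: F_transform_def Im_divide intro!: divide_neg_pos add_nonneg_pos)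
qed


section \<open>Invariance of \<open>C0\<close>\<close>

text \<open>The Cauchy transform of \<open>\<kappa> x\<close> at \<open>z\<close> is
  \<open>1 / (w z - x)\<close>, which is continuous in \<open>x\<close> and tends to 0 as
  \<open>x\<close> leaves every bounded set. \<open>integral_C0_tendsto\<close> transfers both facts
  to the integrals of \<open>f\<close>.\<close>

lemma C0_kernel_integral:
  assumes \<kappa>: "\<And>x. prob_space (\<kappa> x)" "\<And>x. sets (\<kappa> x) = sets borel"
    and F: "\<And>x z. 0 < Im z \<Longrightarrow> F_transform (\<kappa> x) z = w z - complex_of_real x"
    and f: "f \<in> C0"
  shows "(\<lambda>x. integral\<^sup>L (\<kappa> x) f) \<in> C0"
proof -
  note sub = prob_space_imp_subprob_space[OF \<kappa>(1)] \<kappa>(2)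
  have seq: "(\<lambda>n. integral\<^sup>L (\<kappa> (X n)) f) \<longlonglongrightarrow> integral\<^sup>L (\<kappa> x) f"
    if X: "X \<longlonglongrightarrow> x" for X x
  proof (rule integral_C0_tendsto[OF sub sub _ f])
    fix z :: complex assume "0 < Im z"
    \<comment> \<open>The F-transform maps the upper half-plane into itself, so the denominator of
      the limit does not vanish.\<close>
    then have "0 < Im (F_transform (\<kappa> x) z)"
      by (intro Im_F_transform_pos \<kappa>)
    then have "w z - complex_of_real x \<noteq> 0"
      using F[OF \<open>0 < Im z\<close>, of x] by auto
    then show "(\<lambda>n. cauchy_transform (\<kappa> (X n)) z) \<longlonglongrightarrow> cauchy_transform (\<kappa> x) z"
      unfolding cauchy_transform_eq F[OF \<open>0 < Im z\<close>] using tendsto_of_real[OF X, where 'a = complex]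
      by (intro tendsto_divide tendsto_diff tendsto_const)
  qed
  have "continuous_on UNIV (\<lambda>x. integral\<^sup>L (\<kappa> x) f)"
    unfolding continuous_on_sequentially comp_def by (intro allI ballI impI seq) simp
  moreover have "((\<lambda>x. integral\<^sup>L (\<kappa> x) f) \<longlongrightarrow> 0) at_infinity"
  proof (rule ccontr)
    assume "\<not> ?thesis"
    then obtain e where "0 < e" and "\<forall>b. \<exists>x. b \<le> norm x \<and> \<not> dist (integral\<^sup>L (\<kappa> x) f) 0 < e"
      unfolding Lim_at_infinity by blast
    then have "\<forall>n. \<exists>x. real n \<le> norm x \<and> \<not> dist (integral\<^sup>L (\<kappa> x) f) 0 < e"
      by simp
    then obtain X where X: "\<And>n. real n \<le> norm (X n)"
      and far: "\<And>n. \<not> dist (integral\<^sup>L (\<kappa> (X n)) f) 0 < e"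
      using choice[of "\<lambda>n x. real n \<le> norm x \<and> \<not> dist (integral\<^sup>L (\<kappa> x) f) 0 < e"] by blast
    \<comment> \<open>All mass escapes along \<open>X\<close>: the Cauchy transforms tend to 0,
      which is the Cauchy transform of the null measure.\<close>
    have "(\<lambda>n. integral\<^sup>L (\<kappa> (X n)) f) \<longlonglongrightarrow> integral\<^sup>L (null_measure borel) f"
    proof (rule integral_C0_tendsto[OF sub _ _ _ f])
      show "subprob_space (null_measure (borel :: real measure))"
        by (simp add: subprob_space_null_measure)
      fix z :: complex assume z: "0 < Im z"
      have "filterlim (\<lambda>n. norm (w z - complex_of_real (X n))) at_top sequentially"
      proof (rule filterlim_at_top_mono)
        show "filterlim (\<lambda>n. real n - norm (w z)) at_top sequentially"
          using filterlim_tendsto_add_at_top[OF tendsto_const[of "- norm (w z)"] filterlim_real_sequentially] by simp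
        have "real n - norm (w z) \<le> norm (w z - complex_of_real (X n))" for n
          using X[of n] norm_triangle_ineq2[of "complex_of_real (X n)" "w z"] by (simp add: norm_minus_commute)
        then show "\<forall>\<^sub>F n in sequentially. real n - norm (w z) \<le> norm (w z - complex_of_real (X n))"
          by simp
      qed
      then have "(\<lambda>n. 1 / (w z - complex_of_real (X n))) \<longlonglongrightarrow> 0"
        by (intro tendsto_divide_0[OF tendsto_const] filterlim_norm_at_top_imp_at_infinity)
      then show "(\<lambda>n. cauchy_transform (\<kappa> (X n)) z) \<longlonglongrightarrow> cauchy_transform (null_measure borel) z"
        unfolding cauchy_transform_eq[of "\<kappa> _"] F[OF z]
        by (simp add: cauchy_transform_def)
    qed simp
    then have "\<forall>\<^sub>F n in sequentially. dist (integral\<^sup>L (\<kappa> (X n)) f) 0 < e"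
      using \<open>0 < e\<close> by (intro tendstoD) simp_all
    then show False
      using far by (auto simp: eventually_sequentially)
  qed
  ultimately show ?thesis
    by (simp add: C0_def)
qed

section \<open>Integration against a composition of kernels\<close>

text \<open>The real-valued rule \<open>integral_bind\<close> is applied to the real and imaginary
  parts of \<open>f\<close>, both bounded by \<open>B\<close>.\<close>

lemma integral_bind_complex:
  fixes f :: "real \<Rightarrow> complex"
  assumes N: "N \<in> borel \<rightarrow>\<^sub>M subprob_algebra borel"
    and \<mu>: "subprob_space \<mu>" "sets \<mu> = sets borel"
    and f: "f \<in> borel_measurable borel" "\<And>x. norm (f x) \<le> B"
  shows "integral\<^sup>L (\<mu> \<bind> N) f = (LINT y|\<mu>. integral\<^sup>L (N y) f)"
proof -
  interpret subprob_space \<mu> by fact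
  note [measurable] = f(1)
  have N': "N \<in> \<mu> \<rightarrow>\<^sub>M subprob_algebra borel"
    using N by (simp cong: measurable_cong_sets add: \<mu>(2))
  have Nsub: "subprob_space (N y)" "sets (N y) = sets borel" for y
    using measurable_space[OF N, of y] by (auto simp: space_subprob_algebra)
  have int: "integrable \<rho> f" if \<rho>: "subprob_space \<rho>" "sets \<rho> = sets borel" for \<rho>
  proof -
    interpret subprob_space \<rho> by fact
    show ?thesis
      using f by (intro integrable_const_bound[of _ B]) (auto cong: measurable_cong_sets simp: \<rho>(2))
  qed
  have bind_real: "(LINT x|(\<mu> \<bind> N). g x) = (LINT y|\<mu>. LINT x|N y. g x)"
    if g: "g \<in> borel_measurable borel" "\<And>x. \<bar>g x\<bar> \<le> B" for g :: "real \<Rightarrow> real"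
    using subprob_space.emeasure_space_le_1[OF Nsub(1)]
    by (intro integral_bind[OF g(1) g(2) N' finite_measure_axioms, where B' = 1]) auto
  have bind: "subprob_space (\<mu> \<bind> N)" "sets (\<mu> \<bind> N) = sets borel"
    using subprob_space_bind[OF \<mu>(1) N'] sets_bind[of \<mu> N borel] Nsub(2) subprob_not_empty by auto
  have meas: "(\<lambda>y. integral\<^sup>L (N y) f) \<in> borel_measurable borel"
    using N f(1) by (intro measurable_compose[OF N integral_measurable_subprob_algebra]) auto
  have "integrable \<mu> (\<lambda>y. integral\<^sup>L (N y) f)"
    using meas subprob_integral_norm_le[OF Nsub(1) f(2)]
    by (intro integrable_const_bound[of _ B]) (auto cong: measurable_cong_sets simp: \<mu>(2))
  note outer = integral_Re[OF this] integral_Im[OF this]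
  have "\<bar>Re (f x)\<bar> \<le> B" "\<bar>Im (f x)\<bar> \<le> B" for x
    using f(2)[of x] abs_Re_le_cmod[of "f x"] abs_Im_le_cmod[of "f x"] by linarith+
  then have "(LINT x|(\<mu> \<bind> N). Re (f x)) = (LINT y|\<mu>. LINT x|N y. Re (f x))"
    "(LINT x|(\<mu> \<bind> N). Im (f x)) = (LINT y|\<mu>. LINT x|N y. Im (f x))"
    by (intro bind_real; simp)+
  then show ?thesis
    using outer integral_Re[OF int[OF bind]] integral_Im[OF int[OF bind]]
      integral_Re[OF int[OF Nsub]] integral_Im[OF int[OF Nsub]]
    by (simp add: complex_eq_iff)
qed

section \<open>The Feller properties\<close>

theorem theorem4p32:
  fixes P :: "'a measure"
    and \<F> :: "real \<Rightarrow> 'a measure"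
    and M :: "real \<Rightarrow> 'a \<Rightarrow> real"
    and k :: "real \<Rightarrow> real \<Rightarrow> real \<Rightarrow> real measure"
  assumes "markov_process P \<F> M k"
    and "monotone_homogeneous k"
    and "stationary_kernels k"
  shows "Feller_semigroup (\<lambda>t f x. LINT y|k 0 t x. f y)"
proof -
  have trans: "transition_kernels k"
    using assms(1) by (simp add: markov_process_def)
  have kern: "k 0 t \<in> borel \<rightarrow>\<^sub>M prob_algebra borel" if "0 \<le> t" for t
    using trans that by (simp add: transition_kernels_def)
  have kern_sub: "k 0 t \<in> borel \<rightarrow>\<^sub>M subprob_algebra borel" if "0 \<le> t" for t
    using kern[OF that] by (rule measurable_prob_algebraD)
  have prob: "prob_space (k 0 t x)" and sets: "sets (k 0 t x) = sets borel" if "0 \<le> t" for t x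
    using measurable_space[OF kern[OF that], of x] by (auto simp: space_prob_algebra)
  have k0: "k 0 0 x = return borel x" for x
    using trans by (simp add: transition_kernels_def)
  \<comment> \<open>Left convolution with a point mass at \<open>x\<close> subtracts
    \<open>x\<close> from the F-transform; homogeneity is used with starting point 0.\<close>
  have F: "F_transform (k 0 t x) z = F_transform (k 0 t 0) z - complex_of_real x"
    if "0 \<le> t" "0 < Im z" for t x z
  proof -
    have "\<forall>x y. monotone_convolution (return borel x) (k 0 t y) (k 0 t (x + y))"
      using assms(2) that by (auto simp: monotone_homogeneous_def)
    from this[rule_format, of x 0] show ?thesis
      using that by (simp add: monotone_convolution_def F_transform_return)
  qed
  have int: "integrable (k 0 t x) f" if "0 \<le> t" and f: "f \<in> C0" for t x f
  proof -
    interpret prob_space "k 0 t x" using prob that by simp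
    obtain B where "\<And>x. norm (f x) \<le> B" using C0_bounded[OF f] by blast
    then show ?thesis
      using C0_measurable[OF f] sets[OF that(1), of x]
      by (intro integrable_const_bound[of _ B]) (auto cong: measurable_cong_sets)
  qed
  \<comment> \<open>Stationarity replaces the kernel from time \<open>s\<close> to
    \<open>s + t\<close> by \<open>k 0 t\<close>, which turns the Chapman-Kolmogorov equation into a
    monadic bind.\<close>
  have chapman: "k 0 (s + t) x = k 0 s x \<bind> k 0 t" if "0 \<le> s" "0 \<le> t" for s t x
  proof (rule measure_eqI)
    have kern': "k 0 t \<in> k 0 s x \<rightarrow>\<^sub>M subprob_algebra borel"
      using kern_sub that sets[OF that(1)] by (simp cong: measurable_cong_sets)
    have ne: "space (k 0 s x) \<noteq> {}"
      using prob[OF that(1)] by (rule prob_space.not_empty)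
    show "sets (k 0 (s + t) x) = sets (k 0 s x \<bind> k 0 t)"
      using sets that ne by (simp add: sets_bind[of _ _ borel])
    fix A assume "A \<in> sets (k 0 (s + t) x)"
    then have A: "A \<in> sets borel" using sets that by simp
    have "k s (s + t) = k 0 t"
      using assms(3)[unfolded stationary_kernels_def, rule_format, of s "s + t"] that by simp
    moreover have "emeasure (k 0 (s + t) x) A = (\<integral>\<^sup>+ y. emeasure (k s (s + t) y) A \<partial>(k 0 s x))"
      using trans A that unfolding transition_kernels_def by auto
    ultimately show "emeasure (k 0 (s + t) x) A = emeasure (k 0 s x \<bind> k 0 t) A"
      by (simp only: emeasure_bind[OF ne kern' A])
  qed
  \<comment> \<open>Here \<open>F\<close> supplies the hypothesis of
    \<open>C0_kernel_integral\<close>, with \<open>w\<close> the F-transform of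
    \<open>k 0 t 0\<close>.\<close>
  have linear: "linear_operator_C0 (\<lambda>f x. LINT y|k 0 t x. f y)" if "0 \<le> t" for t
    unfolding linear_operator_C0_def
    using that int by (auto intro!: C0_kernel_integral[OF _ _ F] prob sets)
  have semigroup: "(LINT y|k 0 (s + t) x. f y) = (LINT z|k 0 s x. LINT y|k 0 t z. f y)"
    if "0 \<le> s" "0 \<le> t" and f: "f \<in> C0" for s t f x
  proof -
    obtain B where "\<And>x. norm (f x) \<le> B" using C0_bounded[OF f] by blast
    then show ?thesis
      unfolding chapman[OF that(1,2)] using that
      by (intro integral_bind_complex kern_sub prob_space_imp_subprob_space prob sets C0_measurable)
  qed
  have pos: "0 \<le> (LINT y|k 0 t x. f y) \<and> (LINT y|k 0 t x. f y) \<le> 1"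
    if "0 \<le> t" and f: "f \<in> C0" and f01: "\<And>x. 0 \<le> f x \<and> f x \<le> 1" for t f x
  proof -
    interpret prob_space "k 0 t x" using prob that by simp
    \<comment> \<open>In the order on the complex numbers, \<open>0 \<le> f x\<close> forces
      \<open>f x\<close> to be real.\<close>
    have "f = (\<lambda>x. complex_of_real (Re (f x)))"
      using f01 by (auto simp: less_eq_complex_def complex_eq_iff)
    then have "(LINT y|k 0 t x. f y) = complex_of_real (LINT y|k 0 t x. Re (f y))"
      by (metis integral_complex_of_real)
    moreover have "0 \<le> (LINT y|k 0 t x. Re (f y))"
      using f01 by (intro integral_nonneg_AE) (auto simp: less_eq_complex_def)
    moreover have "(LINT y|k 0 t x. Re (f y)) \<le> 1"
      using f01 int[OF that(1,2)] by (intro integral_le_const) (auto simp: less_eq_complex_def)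
    ultimately show ?thesis by (simp add: less_eq_complex_def)
  qed
  have cont: "((\<lambda>t. LINT y|k 0 t x. f y) \<longlongrightarrow> f x) (at_right 0)" if f: "f \<in> C0" for f x
  proof -
    obtain B where B: "\<And>x. norm (f x) \<le> B" using C0_bounded[OF f] by blast
    \<comment> \<open>Weak continuity, stated for real test functions, is restricted to the ray
      \<open>s = 0\<close>; at \<open>t = 0\<close> the kernel is the point mass at
      \<open>x\<close>.\<close>
    have lim: "((\<lambda>t. LINT y|k 0 t x. g y) \<longlongrightarrow> g x) (at_right 0)"
      if g: "continuous_on UNIV g" "\<And>x. \<bar>g x\<bar> \<le> B" for g :: "real \<Rightarrow> real"
    proof -
      have "continuous_on {(s, t). 0 \<le> s \<and> s \<le> t} (\<lambda>(s, t). LINT y|k s t x. g y)"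
        using assms(2) g by (auto simp: monotone_homogeneous_def bounded_iff)
      from continuous_on_compose2[OF this, of "{0..}" "\<lambda>t. (0, t)"]
      have "continuous_on {0..} (\<lambda>t. LINT y|k 0 t x. g y)"
        by (simp add: continuous_on_Pair image_subset_iff)
      then have "((\<lambda>t. LINT y|k 0 t x. g y) \<longlongrightarrow> (LINT y|k 0 0 x. g y)) (at 0 within {0..})"
        by (simp add: continuous_on_def)
      moreover have "(LINT y|k 0 0 x. g y) = g x"
        unfolding k0 using g(1) by (intro integral_return) (auto intro: borel_measurable_continuous_onI)
      ultimately show ?thesis
        by (auto intro: tendsto_within_subset)
    qed
    have "\<bar>Re (f x)\<bar> \<le> B" "\<bar>Im (f x)\<bar> \<le> B" for x
      using B[of x] abs_Re_le_cmod[of "f x"] abs_Im_le_cmod[of "f x"] by linarith+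
    then have "((\<lambda>t. Complex (LINT y|k 0 t x. Re (f y)) (LINT y|k 0 t x. Im (f y))) \<longlongrightarrow> Complex (Re (f x)) (Im (f x))) (at_right 0)"
      using f by (intro tendsto_Complex lim) (auto simp: C0_def intro: continuous_intros)
    \<comment> \<open>Integrability of \<open>f\<close> is available for nonnegative times, so the
      splitting into real and imaginary parts is claimed only to the right of 0.\<close>
    moreover have "\<forall>\<^sub>F t in at_right 0. Complex (LINT y|k 0 t x. Re (f y)) (LINT y|k 0 t x. Im (f y)) = (LINT y|k 0 t x. f y)"
      using eventually_at_right_less by eventually_elim (simp add: int f complex_eq_iff)
    ultimately show ?thesis
      by (simp add: tendsto_cong)
  qed
  have "(LINT y|k 0 0 x. f y) = f x" if "f \<in> C0" for f x
    unfolding k0 using C0_measurable[OF that] by (intro integral_return) auto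
  then show ?thesis
    unfolding Feller_semigroup_def using linear semigroup pos cont by auto
qed

end
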